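(* Let $\mathcal{A}$ be a category and $\mathcal{E}$ a class of arrows in $\mathcal{A}$ which satisfies the axioms (E1)--(E4). The following conditions are equivalent: (i) (E4) holds for the class $\mathcal{E}^1$ in $\mathsf{Ext}\,\mathcal{A}$, that is, for composable morphisms $f,g$ in $\mathsf{Ext}\,\mathcal{A}$, if $g\circ f\in\mathcal{E}^1$ then $g\in\mathcal{E}^1$; (ii) (E5) holds, that is, all split epimorphisms of extensions are in $\mathcal{E}^1$; (iii) every split epimorphism of split epimorphisms is a double extension; that is, given any morphisms $a\colon A_1\to A_0$, $b\colon B_1\to B_0$, $f_1\colon A_1\to B_1$, $f_0\colon A_0\to B_0$, $\overline{a}\colon A_0\to A_1$, $\overline{b}\colon B_0\to B_1$, $\overline{f_1}\colon B_1\to A_1$, $\overline{f_0}\colon B_0\to A_0$ in $\mathcal{A}$ such that $f_0a=bf_1$, $\overline{f_0}b=a\overline{f_1}$, $\overline{b}f_0=f_1\overline{a}$, $\overline{a}\,\overline{f_0}=\overline{f_1}\,\overline{b}$, $f_0\overline{f_0}=1_{B_0}$, $f_1\overline{f_1}=1_{B_1}$, $a\overline{a}=1_{A_0}$ and $b\overline{b}=1_{B_0}$, the square $(f_1,f_0)\colon a\to b$ is in $\mathcal{E}^1$; (iv) for any commutative square $f_0a=bf_1$ in $\mathcal{A}$ with $a\colon A_1\to A_0$, $b\colon B_1\to B_0$, $f_1\colon A_1\to B_1$ and $f_0\colon A_0\to B_0$ all in $\mathcal{E}$, writing $\mathrm{R}[f_1]$ and $\mathrm{R}[f_0]$ for the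 kernel pairs of $f_1$ and $f_0$ and $r\colon\mathrm{R}[f_1]\to\mathrm{R}[f_0]$ for the morphism induced by $a$, the arrow $r$ is in $\mathcal{E}$ if and only if the square $(f_1,f_0)\colon a\to b$ is in $\mathcal{E}^1$.
   Context: Axioms: (E1) $\mathcal{E}$ contains all isomorphisms; (E2) pullbacks of morphisms in $\mathcal{E}$ (along arbitrary morphisms) exist in $\mathcal{A}$ and are in $\mathcal{E}$; (E3) $\mathcal{E}$ is closed under composition; (E4) if $g\circ f\in\mathcal{E}$ then $g\in\mathcal{E}$; (E5) any split epimorphism of extensions is a double extension. Elements of $\mathcal{E}$ are called extensions. $\mathsf{Arr}\,\mathcal{A}$ is the category of arrows of $\mathcal{A}$ (morphisms are commutative squares) and $\mathsf{Ext}\,\mathcal{A}$ its full subcategory on the arrows in $\mathcal{E}$. $\mathcal{E}^1$, the class of double extensions, consists of those morphisms $(f_1,f_0)\colon a\to b$ in $\mathsf{Arr}\,\mathcal{A}$ (with $f_0a=bf_1$) such that $a,b,f_1,f_0$ and the comparison morphism $\langle a,f_1\rangle\colon A_1\to A_0\times_{B_0}B_1$ are all in $\mathcal{E}$. A split epimorphism of extensions is a morphism $(f_1,f_0)\colon a\to b$ with $a,b\in\mathcal{E}$ which has a section in $\mathsf{Arr}\,\mathcal{A}$, i.e. there are $s_i\colon B_i\to A_i$ with $as_1=s_0b$ and $f_is_i=1_{B_i}$ for $i=0,1$. *)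

theory Defs
  imports Main
begin

record ('o, 'm) cat =
  Obj :: "'o set"
  Arr :: "'m set"
  Dom :: "'m \<Rightarrow> 'o"
  Cod :: "'m \<Rightarrow> 'o"
  Ident :: "'o \<Rightarrow> 'm"
  Comp :: "'m \<Rightarrow> 'm \<Rightarrow> 'm"  (infixr "\<cdot>\<index>" 70)

text \<open>Composition is written in the usual order: \<open>g \<cdot> f\<close> is \<open>g\<close> after \<open>f\<close>, and it is
  meaningful only if \<open>Cod f = Dom g\<close>.\<close>

locale category =
  fixes C :: "('o, 'm) cat" (structure)
  assumes Dom_in: "f \<in> Arr C \<Longrightarrow> Dom C f \<in> Obj C"
    and Cod_in: "f \<in> Arr C \<Longrightarrow> Cod C f \<in> Obj C"
    and Ident_in: "A \<in> Obj C \<Longrightarrow> Ident C A \<in> Arr C"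
    and Dom_Ident: "A \<in> Obj C \<Longrightarrow> Dom C (Ident C A) = A"
    and Cod_Ident: "A \<in> Obj C \<Longrightarrow> Cod C (Ident C A) = A"
    and Comp_in: "\<lbrakk>f \<in> Arr C; g \<in> Arr C; Cod C f = Dom C g\<rbrakk> \<Longrightarrow> g \<cdot> f \<in> Arr C"
    and Dom_Comp: "\<lbrakk>f \<in> Arr C; g \<in> Arr C; Cod C f = Dom C g\<rbrakk> \<Longrightarrow> Dom C (g \<cdot> f) = Dom C f"
    and Cod_Comp: "\<lbrakk>f \<in> Arr C; g \<in> Arr C; Cod C f = Dom C g\<rbrakk> \<Longrightarrow> Cod C (g \<cdot> f) = Cod C g"
    and Ident_left: "f \<in> Arr C \<Longrightarrow> Ident C (Cod C f) \<cdot> f = f"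
    and Ident_right: "f \<in> Arr C \<Longrightarrow> f \<cdot> Ident C (Dom C f) = f"
    and Comp_assoc: "\<lbrakk>f \<in> Arr C; g \<in> Arr C; h \<in> Arr C; Cod C f = Dom C g; Cod C g = Dom C h\<rbrakk>
      \<Longrightarrow> (h \<cdot> g) \<cdot> f = h \<cdot> (g \<cdot> f)"

definition Hom :: "('o, 'm) cat \<Rightarrow> 'o \<Rightarrow> 'o \<Rightarrow> 'm set" where
  "Hom C A B = {f \<in> Arr C. Dom C f = A \<and> Cod C f = B}"

definition is_iso :: "('o, 'm) cat \<Rightarrow> 'm \<Rightarrow> bool" where
  "is_iso C f \<longleftrightarrow> f \<in> Arr C \<and>
     (\<exists>g \<in> Hom C (Cod C f) (Dom C f).
        g \<cdot>\<^bsub>C\<^esub> f = Ident C (Dom C f) \<and> f \<cdot>\<^bsub>C\<^esub> g = Ident C (Cod C f))"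

definition is_split_epi :: "('o, 'm) cat \<Rightarrow> 'm \<Rightarrow> bool" where
  "is_split_epi C f \<longleftrightarrow> f \<in> Arr C \<and>
     (\<exists>s \<in> Hom C (Cod C f) (Dom C f). f \<cdot>\<^bsub>C\<^esub> s = Ident C (Cod C f))"

text \<open>\<open>is_pullback C f g p q\<close>: the span \<open>(p, q)\<close> is a pullback of the cospan \<open>(f, g)\<close>, where
  \<open>p\<close> lands in the domain of \<open>f\<close> and \<open>q\<close> in the domain of \<open>g\<close>; thus \<open>q\<close> is a pullback of
  \<open>f\<close> along \<open>g\<close>.\<close>

definition is_pullback :: "('o, 'm) cat \<Rightarrow> 'm \<Rightarrow> 'm \<Rightarrow> 'm \<Rightarrow> 'm \<Rightarrow> bool" where
  "is_pullback C f g p q \<longleftrightarrow>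
     f \<in> Arr C \<and> g \<in> Arr C \<and> p \<in> Arr C \<and> q \<in> Arr C \<and>
     Cod C f = Cod C g \<and> Dom C p = Dom C q \<and> Cod C p = Dom C f \<and> Cod C q = Dom C g \<and>
     f \<cdot>\<^bsub>C\<^esub> p = g \<cdot>\<^bsub>C\<^esub> q \<and>
     (\<forall>X. \<forall>x \<in> Hom C X (Dom C f). \<forall>y \<in> Hom C X (Dom C g). f \<cdot>\<^bsub>C\<^esub> x = g \<cdot>\<^bsub>C\<^esub> y \<longrightarrow>
        (\<exists>!h. h \<in> Hom C X (Dom C p) \<and> p \<cdot>\<^bsub>C\<^esub> h = x \<and> q \<cdot>\<^bsub>C\<^esub> h = y))"

definition is_kernel_pair :: "('o, 'm) cat \<Rightarrow> 'm \<Rightarrow> 'm \<Rightarrow> 'm \<Rightarrow> bool" where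
  "is_kernel_pair C f p q \<longleftrightarrow> is_pullback C f f p q"


text \<open>\<open>Square a f1 f0 b\<close> is the morphism \<open>(f1, f0)\<close> from \<open>a\<close> to \<open>b\<close> in the category of arrows;
  the source and target are recorded because \<open>(f1, f0)\<close> does not determine them.\<close>

datatype 'm square = Square (sq_dom: 'm) (sq_top: 'm) (sq_bot: 'm) (sq_cod: 'm)

definition arrow_cat :: "('o, 'm) cat \<Rightarrow> ('m, 'm square) cat" where
  "arrow_cat C =
    \<lparr> Obj = Arr C,
      Arr = {Square a f1 f0 b | a f1 f0 b.
               a \<in> Arr C \<and> b \<in> Arr C \<and>
               f1 \<in> Hom C (Dom C a) (Dom C b) \<and> f0 \<in> Hom C (Cod C a) (Cod C b) \<and>
               f0 \<cdot>\<^bsub>C\<^esub> a = b \<cdot>\<^bsub>C\<^esub> f1},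
      Dom = sq_dom,
      Cod = sq_cod,
      Ident = (\<lambda>a. Square a (Ident C (Dom C a)) (Ident C (Cod C a)) a),
      Comp = (\<lambda>G F. Square (sq_dom F) (sq_top G \<cdot>\<^bsub>C\<^esub> sq_top F) (sq_bot G \<cdot>\<^bsub>C\<^esub> sq_bot F) (sq_cod G)) \<rparr>"

definition full_subcat :: "('o, 'm) cat \<Rightarrow> 'o set \<Rightarrow> ('o, 'm) cat" where
  "full_subcat C S =
     C\<lparr>Obj := Obj C \<inter> S, Arr := {f \<in> Arr C. Dom C f \<in> S \<and> Cod C f \<in> S}\<rparr>"

definition ext_cat :: "('o, 'm) cat \<Rightarrow> 'm set \<Rightarrow> ('m, 'm square) cat" where
  "ext_cat C E = full_subcat (arrow_cat C) E"

text \<open>The comparison morphism \<open>h = \<langle>a, f1\<rangle>\<close> is formed with respect to some pullback of \<open>f0\<close> and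
  \<open>b\<close>. When \<open>E\<close> satisfies (E1)--(E3) a pullback exists and its choice is immaterial.\<close>

definition double_ext :: "('o, 'm) cat \<Rightarrow> 'm set \<Rightarrow> 'm square set" where
  "double_ext C E =
     {Square a f1 f0 b | a f1 f0 b.
        Square a f1 f0 b \<in> Arr (arrow_cat C) \<and>
        a \<in> E \<and> b \<in> E \<and> f1 \<in> E \<and> f0 \<in> E \<and>
        (\<exists>p q h. is_pullback C f0 b p q \<and> h \<in> Hom C (Dom C a) (Dom C p) \<and>
           p \<cdot>\<^bsub>C\<^esub> h = a \<and> q \<cdot>\<^bsub>C\<^esub> h = f1 \<and> h \<in> E)}"


definition axiom_E1 :: "('o, 'm) cat \<Rightarrow> 'm set \<Rightarrow> bool" where
  "axiom_E1 C E \<longleftrightarrow> (\<forall>f. is_iso C f \<longrightarrow> f \<in> E)"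

definition axiom_E2 :: "('o, 'm) cat \<Rightarrow> 'm set \<Rightarrow> bool" where
  "axiom_E2 C E \<longleftrightarrow> (\<forall>f \<in> E. \<forall>g \<in> Arr C. Cod C f = Cod C g \<longrightarrow>
     (\<exists>p q. is_pullback C f g p q) \<and> (\<forall>p q. is_pullback C f g p q \<longrightarrow> q \<in> E))"

definition axiom_E3 :: "('o, 'm) cat \<Rightarrow> 'm set \<Rightarrow> bool" where
  "axiom_E3 C E \<longleftrightarrow> (\<forall>f \<in> E. \<forall>g \<in> E. Cod C f = Dom C g \<longrightarrow> g \<cdot>\<^bsub>C\<^esub> f \<in> E)"

definition axiom_E4 :: "('o, 'm) cat \<Rightarrow> 'm set \<Rightarrow> bool" where
  "axiom_E4 C E \<longleftrightarrow>
     (\<forall>f \<in> Arr C. \<forall>g \<in> Arr C. Cod C f = Dom C g \<and> g \<cdot>\<^bsub>C\<^esub> f \<in> E \<longrightarrow> g \<in> E)"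

definition is_split_epi_of_ext :: "('o, 'm) cat \<Rightarrow> 'm set \<Rightarrow> 'm square \<Rightarrow> bool" where
  "is_split_epi_of_ext C E F \<longleftrightarrow> F \<in> Arr (ext_cat C E) \<and> is_split_epi (arrow_cat C) F"

definition axiom_E5 :: "('o, 'm) cat \<Rightarrow> 'm set \<Rightarrow> bool" where
  "axiom_E5 C E \<longleftrightarrow> (\<forall>F. is_split_epi_of_ext C E F \<longrightarrow> F \<in> double_ext C E)"


definition split_epis_of_split_epis_double :: "('o, 'm) cat \<Rightarrow> 'm set \<Rightarrow> bool" where
  "split_epis_of_split_epis_double C E \<longleftrightarrow>
     (\<forall>A1 A0 B1 B0 a b f1 f0 a' b' f1' f0'.
        A1 \<in> Obj C \<and> A0 \<in> Obj C \<and> B1 \<in> Obj C \<and> B0 \<in> Obj C \<and>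
        a \<in> Hom C A1 A0 \<and> b \<in> Hom C B1 B0 \<and> f1 \<in> Hom C A1 B1 \<and> f0 \<in> Hom C A0 B0 \<and>
        a' \<in> Hom C A0 A1 \<and> b' \<in> Hom C B0 B1 \<and> f1' \<in> Hom C B1 A1 \<and> f0' \<in> Hom C B0 A0 \<and>
        f0 \<cdot>\<^bsub>C\<^esub> a = b \<cdot>\<^bsub>C\<^esub> f1 \<and> f0' \<cdot>\<^bsub>C\<^esub> b = a \<cdot>\<^bsub>C\<^esub> f1' \<and>
        b' \<cdot>\<^bsub>C\<^esub> f0 = f1 \<cdot>\<^bsub>C\<^esub> a' \<and> a' \<cdot>\<^bsub>C\<^esub> f0' = f1' \<cdot>\<^bsub>C\<^esub> b' \<and>
        f0 \<cdot>\<^bsub>C\<^esub> f0' = Ident C B0 \<and> f1 \<cdot>\<^bsub>C\<^esub> f1' = Ident C B1 \<and>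
        a \<cdot>\<^bsub>C\<^esub> a' = Ident C A0 \<and> b \<cdot>\<^bsub>C\<^esub> b' = Ident C B0
        \<longrightarrow> Square a f1 f0 b \<in> double_ext C E)"

text \<open>Here \<open>(p1, q1)\<close> and \<open>(p0, q0)\<close> are the projections of the kernel pairs \<open>R[f1]\<close> and
  \<open>R[f0]\<close>. Under (E2) they exist, and then \<open>r\<close> exists and is unique by the universal property
  of \<open>R[f0]\<close>.\<close>

definition kernel_pairs_detect_double :: "('o, 'm) cat \<Rightarrow> 'm set \<Rightarrow> bool" where
  "kernel_pairs_detect_double C E \<longleftrightarrow>
     (\<forall>a b f1 f0 p1 q1 p0 q0 r.
        a \<in> E \<and> b \<in> E \<and> f1 \<in> E \<and> f0 \<in> E \<and> Square a f1 f0 b \<in> Arr (arrow_cat C) \<and>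
        is_kernel_pair C f1 p1 q1 \<and> is_kernel_pair C f0 p0 q0 \<and>
        r \<in> Hom C (Dom C p1) (Dom C p0) \<and>
        p0 \<cdot>\<^bsub>C\<^esub> r = a \<cdot>\<^bsub>C\<^esub> p1 \<and> q0 \<cdot>\<^bsub>C\<^esub> r = a \<cdot>\<^bsub>C\<^esub> q1
        \<longrightarrow> (r \<in> E \<longleftrightarrow> Square a f1 f0 b \<in> double_ext C E))"


lemma category_full_subcat:
  assumes "category C"
  shows "category (full_subcat C S)"
proof -
  interpret category C by fact
  show ?thesis
    by (rule category.intro)
      (simp_all add: full_subcat_def Dom_in Cod_in Ident_in Dom_Ident Cod_Ident Comp_in Dom_Comp
        Cod_Comp Ident_left Ident_right Comp_assoc)
qed

lemma category_arrow_cat: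
  assumes "category C"
  shows "category (arrow_cat C)"
proof -
  interpret category C by fact
  let ?A = "arrow_cat C"
  have Arr_iff: "F \<in> Arr ?A \<longleftrightarrow>
      sq_dom F \<in> Arr C \<and> sq_cod F \<in> Arr C \<and> sq_top F \<in> Arr C \<and> sq_bot F \<in> Arr C \<and>
      Dom C (sq_top F) = Dom C (sq_dom F) \<and> Cod C (sq_top F) = Dom C (sq_cod F) \<and>
      Dom C (sq_bot F) = Cod C (sq_dom F) \<and> Cod C (sq_bot F) = Cod C (sq_cod F) \<and>
      sq_bot F \<cdot>\<^bsub>C\<^esub> sq_dom F = sq_cod F \<cdot>\<^bsub>C\<^esub> sq_top F" for F
    by (cases F) (auto simp: arrow_cat_def Hom_def)
  have sel: "Obj ?A = Arr C" "Dom ?A = sq_dom" "Cod ?A = sq_cod"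
    "Ident ?A a = Square a (Ident C (Dom C a)) (Ident C (Cod C a)) a"
    "G \<cdot>\<^bsub>?A\<^esub> F =
      Square (sq_dom F) (sq_top G \<cdot>\<^bsub>C\<^esub> sq_top F) (sq_bot G \<cdot>\<^bsub>C\<^esub> sq_bot F) (sq_cod G)" for a F G
    by (simp_all add: arrow_cat_def)
  have comp: "G \<cdot>\<^bsub>?A\<^esub> F \<in> Arr ?A"
    if F: "F \<in> Arr ?A" and G: "G \<in> Arr ?A" and FG: "sq_cod F = sq_dom G" for F G
  proof -
    have "(sq_bot G \<cdot>\<^bsub>C\<^esub> sq_bot F) \<cdot>\<^bsub>C\<^esub> sq_dom F = sq_bot G \<cdot>\<^bsub>C\<^esub> (sq_bot F \<cdot>\<^bsub>C\<^esub> sq_dom F)"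
      by (rule Comp_assoc) (use F G FG in \<open>simp_all add: Arr_iff\<close>)
    also have "\<dots> = sq_bot G \<cdot>\<^bsub>C\<^esub> (sq_dom G \<cdot>\<^bsub>C\<^esub> sq_top F)"
      using F FG by (simp add: Arr_iff)
    also have "\<dots> = (sq_bot G \<cdot>\<^bsub>C\<^esub> sq_dom G) \<cdot>\<^bsub>C\<^esub> sq_top F"
      by (rule Comp_assoc[symmetric]) (use F G FG in \<open>simp_all add: Arr_iff\<close>)
    also have "\<dots> = (sq_cod G \<cdot>\<^bsub>C\<^esub> sq_top G) \<cdot>\<^bsub>C\<^esub> sq_top F"
      using G by (simp add: Arr_iff)
    also have "\<dots> = sq_cod G \<cdot>\<^bsub>C\<^esub> (sq_top G \<cdot>\<^bsub>C\<^esub> sq_top F)"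
      by (rule Comp_assoc) (use F G FG in \<open>simp_all add: Arr_iff\<close>)
    finally have eq: "(sq_bot G \<cdot>\<^bsub>C\<^esub> sq_bot F) \<cdot>\<^bsub>C\<^esub> sq_dom F =
      sq_cod G \<cdot>\<^bsub>C\<^esub> (sq_top G \<cdot>\<^bsub>C\<^esub> sq_top F)" .
    have top: "Cod C (sq_top F) = Dom C (sq_top G)" and bot: "Cod C (sq_bot F) = Dom C (sq_bot G)"
      using F G FG by (simp_all add: Arr_iff)
    have Fs: "sq_top F \<in> Arr C" "sq_bot F \<in> Arr C" and Gs: "sq_top G \<in> Arr C" "sq_bot G \<in> Arr C"
      using F G by (simp_all add: Arr_iff)
    note top' = Comp_in[OF Fs(1) Gs(1) top] Dom_Comp[OF Fs(1) Gs(1) top] Cod_Comp[OF Fs(1) Gs(1) top]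
      and bot' = Comp_in[OF Fs(2) Gs(2) bot] Dom_Comp[OF Fs(2) Gs(2) bot] Cod_Comp[OF Fs(2) Gs(2) bot]
    show ?thesis
      unfolding sel Arr_iff square.sel top'(2,3) bot'(2,3)
      by (intro conjI top'(1) bot'(1) eq) (use F G in \<open>simp_all add: Arr_iff\<close>)
  qed
  show ?thesis
  proof (rule category.intro)
    fix F assume F: "F \<in> Arr ?A"
    show "Ident ?A (Cod ?A F) \<cdot>\<^bsub>?A\<^esub> F = F"
      using F Ident_left[of "sq_top F"] Ident_left[of "sq_bot F"] by (cases F) (simp add: sel Arr_iff)
    show "F \<cdot>\<^bsub>?A\<^esub> Ident ?A (Dom ?A F) = F"
      using F Ident_right[of "sq_top F"] Ident_right[of "sq_bot F"] by (cases F) (simp add: sel Arr_iff)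
  next
    fix F G H
    assume "F \<in> Arr ?A" "G \<in> Arr ?A" "H \<in> Arr ?A" "Cod ?A F = Dom ?A G" "Cod ?A G = Dom ?A H"
    then show "(H \<cdot>\<^bsub>?A\<^esub> G) \<cdot>\<^bsub>?A\<^esub> F = H \<cdot>\<^bsub>?A\<^esub> (G \<cdot>\<^bsub>?A\<^esub> F)"
      by (simp add: sel Arr_iff Comp_assoc)
  next
    fix a assume "a \<in> Obj ?A"
    then show "Ident ?A a \<in> Arr ?A"
      by (simp add: sel Arr_iff Dom_in Cod_in Ident_in Dom_Ident Cod_Ident Ident_left Ident_right)
  qed (use comp in \<open>simp_all add: sel, simp_all add: Arr_iff\<close>)
qed

end

(* Everything rests on one observation about a pointwise pullback of a square g : b -> c along a
   square k : a -> c, with projection p onto a: the comparison morphism of p is a pullback of that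
   of g, along a morphism m which is itself a pullback of k1. So if k1 is in E and p is a double
   extension, then g is one by (E4); and if k is a double extension and b is in E, then the vertex
   of the pullback is in E. Kernel pairs are the case k = g. If k = g o f, then p is a split
   epimorphism with section (1, f), so that (E5) applies to it: for f = 1 this gives (ii) => (iv),
   for general f it gives (ii) => (i). For (iii) => (ii), the same descent is applied to the
   transpose of a split epimorphism of extensions, whose kernel pair projection is a split
   epimorphism of split epimorphisms. *)

theory Submission
  imports Defs
begin

section \<open>Pullback calculus in a category\<close>

context category
begin

text \<open>\<open>Comp_assoc\<close> carries conditions on domains and codomains, which makes it
  awkward to use a commuting square inside a longer composite. This rule does it in one step and
  leaves only typing goals for the simplifier.\<close>

lemma Comp_eq_extend:
  assumes "f \<cdot> g = h \<cdot> k" "x \<in> Arr C" "Cod C x = Dom C g" "Cod C x = Dom C k"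
    and "f \<in> Arr C" "g \<in> Arr C" "h \<in> Arr C" "k \<in> Arr C" "Cod C g = Dom C f" "Cod C k = Dom C h"
  shows "f \<cdot> (g \<cdot> x) = h \<cdot> (k \<cdot> x)"
  using assms Comp_assoc[of x g f] Comp_assoc[of x k h] by simp

lemma is_pullback_arrs:
  assumes "is_pullback C f g p q"
  shows "f \<in> Arr C" "g \<in> Arr C" "p \<in> Arr C" "q \<in> Arr C" "Cod C f = Cod C g"
    "Dom C p = Dom C q" "Cod C p = Dom C f" "Cod C q = Dom C g" "f \<cdot> p = g \<cdot> q"
  using assms by (simp_all add: is_pullback_def)

lemma is_pullback_unique:
  assumes pb: "is_pullback C f g p q"
    and x: "x \<in> Arr C" "Cod C x = Dom C p" and y: "y \<in> Arr C" "Cod C y = Dom C p"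
    and xy: "Dom C x = Dom C y" "p \<cdot> x = p \<cdot> y" "q \<cdot> x = q \<cdot> y"
  shows "x = y"
proof -
  note pb' = is_pullback_arrs[OF pb]
  have "p \<cdot> x \<in> Hom C (Dom C x) (Dom C f)" "q \<cdot> x \<in> Hom C (Dom C x) (Dom C g)"
    using pb' x by (simp_all add: Hom_def Comp_in Dom_Comp Cod_Comp)
  moreover have "f \<cdot> (p \<cdot> x) = g \<cdot> (q \<cdot> x)"
    by (rule Comp_eq_extend) (use pb' x in simp_all)
  ultimately have "\<exists>!h. h \<in> Hom C (Dom C x) (Dom C p) \<and> p \<cdot> h = p \<cdot> x \<and> q \<cdot> h = q \<cdot> x"
    using pb unfolding is_pullback_def by blast
  moreover have "x \<in> Hom C (Dom C x) (Dom C p)" "y \<in> Hom C (Dom C x) (Dom C p)"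
    using x y xy by (simp_all add: Hom_def)
  ultimately show ?thesis using xy by metis
qed

lemma is_pullback_induce:
  assumes pb: "is_pullback C f g p q"
    and "x \<in> Arr C" "y \<in> Arr C" "Dom C x = Dom C y" "Cod C x = Dom C f" "Cod C y = Dom C g"
    and "f \<cdot> x = g \<cdot> y"
  obtains h where "h \<in> Arr C" "Dom C h = Dom C x" "Cod C h = Dom C p" "p \<cdot> h = x" "q \<cdot> h = y"
proof -
  have "x \<in> Hom C (Dom C x) (Dom C f)" "y \<in> Hom C (Dom C x) (Dom C g)"
    using assms by (simp_all add: Hom_def)
  then have "\<exists>!h. h \<in> Hom C (Dom C x) (Dom C p) \<and> p \<cdot> h = x \<and> q \<cdot> h = y"
    using assms unfolding is_pullback_def by blast
  then show thesis using that by (auto simp: Hom_def)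
qed

text \<open>Splits the unique existence in \<open>is_pullback\<close> into a mediating arrow and
  joint monicity of the projections; the test object is read off as \<open>Dom C x\<close>.\<close>

lemma is_pullbackI:
  assumes "f \<in> Arr C" "g \<in> Arr C" "p \<in> Arr C" "q \<in> Arr C" "Cod C f = Cod C g"
    "Dom C p = Dom C q" "Cod C p = Dom C f" "Cod C q = Dom C g" "f \<cdot> p = g \<cdot> q"
    and ex: "\<And>x y. \<lbrakk>x \<in> Arr C; y \<in> Arr C; Dom C x = Dom C y; Cod C x = Dom C f; Cod C y = Dom C g;
      f \<cdot> x = g \<cdot> y\<rbrakk>
      \<Longrightarrow> \<exists>h. h \<in> Arr C \<and> Dom C h = Dom C x \<and> Cod C h = Dom C p \<and> p \<cdot> h = x \<and> q \<cdot> h = y"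
    and un: "\<And>x y. \<lbrakk>x \<in> Arr C; Cod C x = Dom C p; y \<in> Arr C; Cod C y = Dom C p; Dom C x = Dom C y;
      p \<cdot> x = p \<cdot> y; q \<cdot> x = q \<cdot> y\<rbrakk> \<Longrightarrow> x = y"
  shows "is_pullback C f g p q"
proof -
  have "\<exists>!h. h \<in> Hom C X (Dom C p) \<and> p \<cdot> h = x \<and> q \<cdot> h = y"
    if "x \<in> Hom C X (Dom C f)" "y \<in> Hom C X (Dom C g)" "f \<cdot> x = g \<cdot> y" for X x y
  proof -
    have "x \<in> Arr C" "y \<in> Arr C" "Dom C x = Dom C y" "Cod C x = Dom C f" "Cod C y = Dom C g"
      and X: "Dom C x = X"
      using that by (simp_all add: Hom_def)
    from ex[OF this(1-5) that(3)] X
    obtain h where h: "h \<in> Hom C X (Dom C p) \<and> p \<cdot> h = x \<and> q \<cdot> h = y"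
      by (auto simp: Hom_def)
    have "h' = h" if "h' \<in> Hom C X (Dom C p) \<and> p \<cdot> h' = x \<and> q \<cdot> h' = y" for h'
      by (rule un) (use that h in \<open>simp_all add: Hom_def\<close>)
    with h show ?thesis by blast
  qed
  with assms(1-9) show ?thesis unfolding is_pullback_def by blast
qed

lemma is_pullback_sym:
  assumes "is_pullback C f g p q"
  shows "is_pullback C g f q p"
proof (rule is_pullbackI)
  fix x y
  assume "x \<in> Arr C" "y \<in> Arr C" "Dom C x = Dom C y" "Cod C x = Dom C g" "Cod C y = Dom C f"
    "g \<cdot> x = f \<cdot> y"
  then obtain h where
    "h \<in> Arr C" "Dom C h = Dom C y" "Cod C h = Dom C p" "p \<cdot> h = y" "q \<cdot> h = x"
    using is_pullback_induce[OF assms, of y x] by metis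
  then show "\<exists>h. h \<in> Arr C \<and> Dom C h = Dom C x \<and> Cod C h = Dom C q \<and> q \<cdot> h = x \<and> p \<cdot> h = y"
    using is_pullback_arrs[OF assms] \<open>Dom C x = Dom C y\<close> by auto
qed (use is_pullback_arrs[OF assms] is_pullback_unique[OF assms] in simp_all)

text \<open>A cone over the outer rectangle is lifted first through the square of \<open>p\<close>
  and \<open>q\<close>, and the resulting arrow then through that of \<open>p'\<close> and
  \<open>q'\<close>.\<close>

lemma is_pullback_paste:
  assumes r: "is_pullback C f g p q" and l: "is_pullback C q g' p' q'"
  shows "is_pullback C f (g \<cdot> g') (p \<cdot> p') q'"
proof -
  note r' = is_pullback_arrs[OF r] and l' = is_pullback_arrs[OF l]
  show ?thesis
  proof (rule is_pullbackI)
    have "f \<cdot> (p \<cdot> p') = g \<cdot> (q \<cdot> p')"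
      by (rule Comp_eq_extend) (use r' l' in simp_all)
    then show "f \<cdot> (p \<cdot> p') = (g \<cdot> g') \<cdot> q'"
      using r' l' by (simp add: Comp_assoc)
  next
    fix x y
    assume xy: "x \<in> Arr C" "y \<in> Arr C" "Dom C x = Dom C y" "Cod C x = Dom C f"
      "Cod C y = Dom C (g \<cdot> g')" "f \<cdot> x = (g \<cdot> g') \<cdot> y"
    then have y: "Cod C y = Dom C g'" using r' l' by (simp add: Dom_Comp)
    then obtain u where u: "u \<in> Arr C" "Dom C u = Dom C x" "Cod C u = Dom C p" "p \<cdot> u = x"
      "q \<cdot> u = g' \<cdot> y"
      using is_pullback_induce[OF r, of x "g' \<cdot> y"] xy r' l'
      by (auto simp: Comp_in Dom_Comp Cod_Comp Comp_assoc)
    then obtain h where "h \<in> Arr C" "Dom C h = Dom C u" "Cod C h = Dom C p'" "p' \<cdot> h = u"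
      "q' \<cdot> h = y"
      using is_pullback_induce[OF l, of u y] xy y r' l' by auto
    then show "\<exists>h. h \<in> Arr C \<and> Dom C h = Dom C x \<and> Cod C h = Dom C (p \<cdot> p') \<and>
        (p \<cdot> p') \<cdot> h = x \<and> q' \<cdot> h = y"
      using u r' l' by (intro exI[of _ h]) (simp add: Dom_Comp Comp_assoc)
  next
    fix x y
    assume xy: "x \<in> Arr C" "Cod C x = Dom C (p \<cdot> p')" "y \<in> Arr C" "Cod C y = Dom C (p \<cdot> p')"
      "Dom C x = Dom C y" "(p \<cdot> p') \<cdot> x = (p \<cdot> p') \<cdot> y" "q' \<cdot> x = q' \<cdot> y"
    then have xy': "Cod C x = Dom C p'" "Cod C y = Dom C p'"
      using r' l' by (simp_all add: Dom_Comp)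
    have eqs: "q \<cdot> (p' \<cdot> x) = g' \<cdot> (q' \<cdot> x)" "q \<cdot> (p' \<cdot> y) = g' \<cdot> (q' \<cdot> y)"
      by (rule Comp_eq_extend; use xy xy' r' l' in simp)+
    have "p' \<cdot> x = p' \<cdot> y"
      by (rule is_pullback_unique[OF r])
        (use eqs xy xy' r' l' in \<open>simp_all add: Comp_in Dom_Comp Cod_Comp Comp_assoc\<close>)
    then show "x = y"
      using is_pullback_unique[OF l] xy xy' by blast
  qed (use r' l' in \<open>simp_all add: Comp_in Dom_Comp Cod_Comp\<close>)
qed

text \<open>The converse half of pasting. Composing with \<open>p\<close> turns a cone over the
  inner square into one over the rectangle; the arrow induced there also has the right composite
  with \<open>p'\<close>, since \<open>p\<close> and \<open>q\<close> are jointly monic.\<close>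

lemma is_pullback_cancel:
  assumes r: "is_pullback C f g p q" and o: "is_pullback C f (g \<cdot> g') (p \<cdot> p') q'"
    and l: "g' \<in> Arr C" "p' \<in> Arr C" "Cod C g' = Dom C g" "Cod C p' = Dom C p"
      "q \<cdot> p' = g' \<cdot> q'"
  shows "is_pullback C q g' p' q'"
proof -
  note r' = is_pullback_arrs[OF r] and o' = is_pullback_arrs[OF o]
  note gg = Dom_Comp[OF l(1) r'(2) l(3)] and pp = Dom_Comp[OF l(2) r'(3) l(4)]
  show ?thesis
  proof (rule is_pullbackI)
    fix x y
    assume xy: "x \<in> Arr C" "y \<in> Arr C" "Dom C x = Dom C y" "Cod C x = Dom C q"
      "Cod C y = Dom C g'" "q \<cdot> x = g' \<cdot> y"
    have "f \<cdot> (p \<cdot> x) = g \<cdot> (q \<cdot> x)"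
      by (rule Comp_eq_extend) (use r' xy in simp_all)
    then have "f \<cdot> (p \<cdot> x) = (g \<cdot> g') \<cdot> y"
      using xy l r' by (simp add: Comp_assoc)
    then obtain h where h: "h \<in> Arr C" "Dom C h = Dom C x" "Cod C h = Dom C p'"
      "(p \<cdot> p') \<cdot> h = p \<cdot> x" "q' \<cdot> h = y"
      using is_pullback_induce[OF o, of "p \<cdot> x" y] xy r' gg pp
      by (auto simp: Comp_in Dom_Comp Cod_Comp)
    have "q \<cdot> (p' \<cdot> h) = g' \<cdot> (q' \<cdot> h)"
      by (rule Comp_eq_extend) (use h l r' o' pp gg in simp_all)
    then have "q \<cdot> (p' \<cdot> h) = q \<cdot> x"
      using h xy by simp
    then have "p' \<cdot> h = x"
      by (rule is_pullback_unique[OF r, rotated -1])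
        (use h xy l r' in \<open>simp_all add: Comp_in Dom_Comp Cod_Comp Comp_assoc\<close>)
    with h show "\<exists>h. h \<in> Arr C \<and> Dom C h = Dom C x \<and> Cod C h = Dom C p' \<and> p' \<cdot> h = x \<and> q' \<cdot> h = y"
      by blast
  next
    fix x y
    assume xy: "x \<in> Arr C" "Cod C x = Dom C p'" "y \<in> Arr C" "Cod C y = Dom C p'"
      "Dom C x = Dom C y" "p' \<cdot> x = p' \<cdot> y" "q' \<cdot> x = q' \<cdot> y"
    show "x = y"
      by (rule is_pullback_unique[OF o]) (use xy l r' pp in \<open>simp_all add: Comp_assoc\<close>)
  qed (use r' o' l gg pp in simp_all)
qed

lemma is_pullback_Ident:
  assumes "b \<in> Arr C"
  shows "is_pullback C (Ident C (Cod C b)) b b (Ident C (Dom C b))"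
proof (rule is_pullbackI)
  fix x y
  assume "x \<in> Arr C" "y \<in> Arr C" "Dom C x = Dom C y" "Cod C x = Dom C (Ident C (Cod C b))"
    "Cod C y = Dom C b" "Ident C (Cod C b) \<cdot> x = b \<cdot> y"
  then show "\<exists>h. h \<in> Arr C \<and> Dom C h = Dom C x \<and> Cod C h = Dom C b \<and> b \<cdot> h = x \<and>
      Ident C (Dom C b) \<cdot> h = y"
    using assms Ident_left[of x] Ident_left[of y]
    by (intro exI[of _ y]) (simp add: Cod_in Dom_Ident)
next
  fix x y
  assume "x \<in> Arr C" "Cod C x = Dom C b" "y \<in> Arr C" "Cod C y = Dom C b"
    "Ident C (Dom C b) \<cdot> x = Ident C (Dom C b) \<cdot> y"
  then show "x = y" using Ident_left[of x] Ident_left[of y] by simp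
qed (use assms in \<open>simp_all add: Ident_in Dom_in Cod_in Dom_Ident Cod_Ident Ident_left Ident_right\<close>)

section \<open>The category of arrows and comparison morphisms\<close>

lemma Arr_arrow_cat_iff:
  "Square a f1 f0 b \<in> Arr (arrow_cat C) \<longleftrightarrow>
     a \<in> Arr C \<and> b \<in> Arr C \<and> f1 \<in> Arr C \<and> f0 \<in> Arr C \<and>
     Dom C f1 = Dom C a \<and> Cod C f1 = Dom C b \<and> Dom C f0 = Cod C a \<and> Cod C f0 = Cod C b \<and>
     f0 \<cdot> a = b \<cdot> f1"
  by (auto simp: arrow_cat_def Hom_def)

lemma arrow_cat_simps:
  "Dom (arrow_cat C) F = sq_dom F" "Cod (arrow_cat C) F = sq_cod F"
  "Ident (arrow_cat C) b = Square b (Ident C (Dom C b)) (Ident C (Cod C b)) b"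
  "G \<cdot>\<^bsub>arrow_cat C\<^esub> F =
    Square (sq_dom F) (sq_top G \<cdot> sq_top F) (sq_bot G \<cdot> sq_bot F) (sq_cod G)"
  by (simp_all add: arrow_cat_def)

lemma is_split_epi_square_iff:
  "is_split_epi (arrow_cat C) (Square a f1 f0 b) \<longleftrightarrow>
     Square a f1 f0 b \<in> Arr (arrow_cat C) \<and>
     (\<exists>s1 s0. Square b s1 s0 a \<in> Arr (arrow_cat C) \<and>
        f1 \<cdot> s1 = Ident C (Dom C b) \<and> f0 \<cdot> s0 = Ident C (Cod C b))"
proof -
  have "(\<exists>S \<in> Hom (arrow_cat C) b a. P S) \<longleftrightarrow>
      (\<exists>s1 s0. Square b s1 s0 a \<in> Arr (arrow_cat C) \<and> P (Square b s1 s0 a))" for P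
    by (auto simp: Hom_def arrow_cat_simps) (metis square.collapse)
  then show ?thesis
    by (simp add: is_split_epi_def arrow_cat_simps)
qed

end

text \<open>Names the data under the existential of \<open>double_ext\<close>, for any pullback
  rather than a chosen one. Membership in \<open>E\<close> is left out, so that a comparison can be
  fixed first and shown to lie in \<open>E\<close> later.\<close>

definition is_comparison :: "('o, 'm) cat \<Rightarrow> 'm square \<Rightarrow> 'm \<Rightarrow> 'm \<Rightarrow> 'm \<Rightarrow> bool" where
  "is_comparison C F p q h \<longleftrightarrow> is_pullback C (sq_bot F) (sq_cod F) p q \<and>
     h \<in> Arr C \<and> Dom C h = Dom C (sq_dom F) \<and> Cod C h = Dom C p \<and>
     p \<cdot>\<^bsub>C\<^esub> h = sq_dom F \<and> q \<cdot>\<^bsub>C\<^esub> h = sq_top F"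

lemma double_ext_iff:
  "Square a f1 f0 b \<in> double_ext C E \<longleftrightarrow>
     Square a f1 f0 b \<in> Arr (arrow_cat C) \<and> a \<in> E \<and> b \<in> E \<and> f1 \<in> E \<and> f0 \<in> E \<and>
     (\<exists>p q h. is_comparison C (Square a f1 f0 b) p q h \<and> h \<in> E)"
  by (simp add: double_ext_def is_comparison_def Hom_def conj_ac)

section \<open>Pullbacks of squares, formed pointwise on domains and codomains\<close>

locale arrow_pullback = category C
  for C :: "('o, 'm) cat" (structure) and a b c d k1 k0 g1 g0 p1 p0 q1 q0 :: 'm +
  assumes k: "Square a k1 k0 c \<in> Arr (arrow_cat C)"
    and g: "Square b g1 g0 c \<in> Arr (arrow_cat C)"
    and p: "Square d p1 p0 a \<in> Arr (arrow_cat C)"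
    and q: "Square d q1 q0 b \<in> Arr (arrow_cat C)"
    and pb1: "is_pullback C k1 g1 p1 q1"
    and pb0: "is_pullback C k0 g0 p0 q0"
begin

lemmas arrs = k[unfolded Arr_arrow_cat_iff] g[unfolded Arr_arrow_cat_iff]
  p[unfolded Arr_arrow_cat_iff] q[unfolded Arr_arrow_cat_iff]

lemma swap: "arrow_pullback C b a c d g1 g0 k1 k0 q1 q0 p1 p0"
  by unfold_locales (rule g k q p is_pullback_sym[OF pb1] is_pullback_sym[OF pb0])+

text \<open>Let U and W be the domains of \<open>u\<close> and \<open>w\<close>. By pasting with
  \<open>pb0\<close>, W is the pullback of \<open>g0\<close> along
  \<open>k0 \<cdot> a = c \<cdot> k1\<close>. Cancelling the square of U leaves W as the pullback of
  \<open>v\<close> along \<open>k1\<close>, with \<open>m\<close> the projection to U. Since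
  \<open>g1 = v \<cdot> h\<close>, cancelling this square in turn from \<open>pb1\<close> leaves the
  pullback of \<open>h\<close> along \<open>m\<close>.\<close>

lemma comparison_pullback:
  assumes g_cmp: "is_comparison C (Square b g1 g0 c) u v h"
    and p_cmp: "is_comparison C (Square d p1 p0 a) w z l"
  obtains m where "is_pullback C k1 v z m" "is_pullback C h m q1 l"
proof -
  have uv: "is_pullback C g0 c u v" and h: "h \<in> Arr C" "Dom C h = Dom C b" "Cod C h = Dom C u"
      "u \<cdot> h = b" "v \<cdot> h = g1"
    using g_cmp by (simp_all add: is_comparison_def)
  have wz: "is_pullback C p0 a w z" and l: "l \<in> Arr C" "Dom C l = Dom C d" "Cod C l = Dom C w"
      "w \<cdot> l = d" "z \<cdot> l = p1"
    using p_cmp by (simp_all add: is_comparison_def)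
  note uv' = is_pullback_arrs[OF uv] and wz' = is_pullback_arrs[OF wz]
    and pb1' = is_pullback_arrs[OF pb1]
  have outer: "is_pullback C g0 (k0 \<cdot> a) (q0 \<cdot> w) z"
    by (rule is_pullback_paste[OF is_pullback_sym[OF pb0] wz])
  note outer' = is_pullback_arrs[OF outer]
  have "g0 \<cdot> (q0 \<cdot> w) = c \<cdot> (k1 \<cdot> z)"
    using outer'(9) arrs wz' by (simp add: Comp_assoc)
  then obtain m where m: "m \<in> Arr C" "Dom C m = Dom C w" "Cod C m = Dom C u"
    "u \<cdot> m = q0 \<cdot> w" "v \<cdot> m = k1 \<cdot> z"
    using is_pullback_induce[OF uv, of "q0 \<cdot> w" "k1 \<cdot> z"] arrs wz'
    by (auto simp: Comp_in Dom_Comp Cod_Comp)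
  have "is_pullback C v k1 m z"
    by (rule is_pullback_cancel[OF uv]) (use outer m arrs in simp_all)
  then have zm: "is_pullback C k1 v z m"
    by (rule is_pullback_sym)
  \<comment> \<open>Commutativity of the square on \<open>m\<close>, \<open>l\<close>,
    \<open>h\<close>, \<open>q1\<close> is tested against the jointly monic \<open>v\<close> and
    \<open>u\<close>.\<close>
  have v_eq: "v \<cdot> (m \<cdot> l) = v \<cdot> (h \<cdot> q1)"
  proof -
    have "v \<cdot> (m \<cdot> l) = k1 \<cdot> (z \<cdot> l)"
      by (rule Comp_eq_extend) (use m l arrs uv' wz' in simp_all)
    also have "\<dots> = (v \<cdot> h) \<cdot> q1"
      using l h pb1' by simp
    also have "\<dots> = v \<cdot> (h \<cdot> q1)"
      by (rule Comp_assoc) (use arrs h uv' in simp_all)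
    finally show ?thesis .
  qed
  have u_eq: "u \<cdot> (m \<cdot> l) = u \<cdot> (h \<cdot> q1)"
  proof -
    have "u \<cdot> (m \<cdot> l) = q0 \<cdot> (w \<cdot> l)"
      by (rule Comp_eq_extend) (use m l arrs uv' wz' in simp_all)
    also have "\<dots> = (u \<cdot> h) \<cdot> q1"
      using l h arrs by simp
    also have "\<dots> = u \<cdot> (h \<cdot> q1)"
      by (rule Comp_assoc) (use arrs h uv' in simp_all)
    finally show ?thesis .
  qed
  have "m \<cdot> l = h \<cdot> q1"
    by (rule is_pullback_unique[OF uv])
      (use u_eq v_eq m l h arrs wz' in \<open>simp_all add: Comp_in Dom_Comp Cod_Comp\<close>)
  then have "is_pullback C m h l q1"
    by (rule is_pullback_cancel[OF zm, rotated -1]) (use pb1 l h uv' wz' in simp_all)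
  then show thesis
    using that zm is_pullback_sym by blast
qed

text \<open>The components are induced by the pairs (1, \<open>f1\<close>) and (1,
  \<open>f0\<close>), and they form a square because \<open>p0\<close> and \<open>q0\<close> are
  jointly monic. When \<open>k = g\<close> and \<open>f\<close> is an identity square, they are the
  diagonals of two kernel pairs; the equations for \<open>q1\<close> and \<open>q0\<close> record
  this.\<close>

lemma section_of_factorization:
  assumes f: "Square a f1 f0 b \<in> Arr (arrow_cat C)" "g1 \<cdot> f1 = k1" "g0 \<cdot> f0 = k0"
  obtains s1 s0 where "Square a s1 s0 d \<in> Arr (arrow_cat C)"
    "p1 \<cdot> s1 = Ident C (Dom C a)" "p0 \<cdot> s0 = Ident C (Cod C a)" "q1 \<cdot> s1 = f1" "q0 \<cdot> s0 = f0"
proof -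
  note f' = f(1)[unfolded Arr_arrow_cat_iff]
  have idents: "Ident C (Dom C a) \<in> Arr C" "Dom C (Ident C (Dom C a)) = Dom C a"
      "Cod C (Ident C (Dom C a)) = Dom C a" "Ident C (Cod C a) \<in> Arr C"
      "Dom C (Ident C (Cod C a)) = Cod C a" "Cod C (Ident C (Cod C a)) = Cod C a"
      "k1 \<cdot> Ident C (Dom C a) = k1" "k0 \<cdot> Ident C (Cod C a) = k0"
    using arrs Ident_right[of k1] Ident_right[of k0]
    by (simp_all add: Ident_in Dom_Ident Cod_Ident Dom_in Cod_in)
  obtain s1 where s1: "s1 \<in> Arr C" "Dom C s1 = Dom C a" "Cod C s1 = Dom C p1"
    "p1 \<cdot> s1 = Ident C (Dom C a)" "q1 \<cdot> s1 = f1"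
    using is_pullback_induce[OF pb1, of "Ident C (Dom C a)" f1] arrs f f' idents by auto
  obtain s0 where s0: "s0 \<in> Arr C" "Dom C s0 = Cod C a" "Cod C s0 = Dom C p0"
    "p0 \<cdot> s0 = Ident C (Cod C a)" "q0 \<cdot> s0 = f0"
    using is_pullback_induce[OF pb0, of "Ident C (Cod C a)" f0] arrs f f' idents by auto
  have "d \<cdot> s1 = s0 \<cdot> a"
  proof (rule is_pullback_unique[OF pb0])
    have "p0 \<cdot> (d \<cdot> s1) = a \<cdot> (p1 \<cdot> s1)"
      by (rule Comp_eq_extend) (use s1 arrs in simp_all)
    also have "\<dots> = (p0 \<cdot> s0) \<cdot> a"
      using s1 s0 arrs by (simp add: Ident_left Ident_right)
    also have "\<dots> = p0 \<cdot> (s0 \<cdot> a)"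
      by (rule Comp_assoc) (use s0 arrs in simp_all)
    finally show "p0 \<cdot> (d \<cdot> s1) = p0 \<cdot> (s0 \<cdot> a)" .
    have "q0 \<cdot> (d \<cdot> s1) = b \<cdot> (q1 \<cdot> s1)"
      by (rule Comp_eq_extend) (use s1 arrs in simp_all)
    also have "\<dots> = (q0 \<cdot> s0) \<cdot> a"
      using s1 s0 f' by simp
    also have "\<dots> = q0 \<cdot> (s0 \<cdot> a)"
      by (rule Comp_assoc) (use s0 arrs in simp_all)
    finally show "q0 \<cdot> (d \<cdot> s1) = q0 \<cdot> (s0 \<cdot> a)" .
  qed (use s1 s0 arrs in \<open>simp_all add: Comp_in Dom_Comp Cod_Comp\<close>)
  then have "Square a s1 s0 d \<in> Arr (arrow_cat C)"
    using s1 s0 arrs by (simp add: Arr_arrow_cat_iff)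
  with s1 s0 show thesis
    by (intro that)
qed

end

lemma (in category) arrow_pullback_induce:
  assumes k: "Square a k1 k0 c \<in> Arr (arrow_cat C)" and g: "Square b g1 g0 c \<in> Arr (arrow_cat C)"
    and pb1: "is_pullback C k1 g1 p1 q1" and pb0: "is_pullback C k0 g0 p0 q0"
  obtains d where "arrow_pullback C a b c d k1 k0 g1 g0 p1 p0 q1 q0"
proof -
  note arrs = k[unfolded Arr_arrow_cat_iff] g[unfolded Arr_arrow_cat_iff]
    is_pullback_arrs[OF pb1] is_pullback_arrs[OF pb0]
  have "k0 \<cdot> (a \<cdot> p1) = c \<cdot> (k1 \<cdot> p1)" "g0 \<cdot> (b \<cdot> q1) = c \<cdot> (g1 \<cdot> q1)"
    by (rule Comp_eq_extend; use arrs in simp)+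
  then obtain d where "d \<in> Arr C" "Dom C d = Dom C p1" "Cod C d = Dom C p0"
    "p0 \<cdot> d = a \<cdot> p1" "q0 \<cdot> d = b \<cdot> q1"
    using is_pullback_induce[OF pb0, of "a \<cdot> p1" "b \<cdot> q1"] arrs
    by (auto simp: Comp_in Dom_Comp Cod_Comp)
  then have "arrow_pullback C a b c d k1 k0 g1 g0 p1 p0 q1 q0"
    by unfold_locales (use assms arrs in \<open>simp_all add: Arr_arrow_cat_iff\<close>)
  then show thesis by (rule that)
qed

lemma (in arrow_pullback) section_of_vertex:
  assumes sa: "Square s k0 k1 t \<in> Arr (arrow_cat C)" "a \<cdot> s = Ident C (Cod C a)"
    and sb: "Square r g0 g1 t \<in> Arr (arrow_cat C)" "b \<cdot> r = Ident C (Cod C b)"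
  obtains e where "Square e p0 p1 s \<in> Arr (arrow_cat C)" "Square e q0 q1 r \<in> Arr (arrow_cat C)"
    "d \<cdot> e = Ident C (Cod C d)"
proof -
  obtain e where "arrow_pullback C s r t e k0 k1 g0 g1 p0 p1 q0 q1"
    using arrow_pullback_induce[OF sa(1) sb(1) pb0 pb1] by blast
  then interpret e: arrow_pullback C s r t e k0 k1 g0 g1 p0 p1 q0 q1 .
  note arrs' = arrs e.arrs
  have "d \<cdot> e = Ident C (Cod C d)"
  proof (rule is_pullback_unique[OF pb0])
    have "p0 \<cdot> (d \<cdot> e) = a \<cdot> (p1 \<cdot> e)"
      by (rule Comp_eq_extend) (use arrs' in simp_all)
    also have "\<dots> = (a \<cdot> s) \<cdot> p0"
      using arrs' by (simp add: Comp_assoc)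
    also have "\<dots> = p0 \<cdot> Ident C (Cod C d)"
      using arrs' sa Ident_left[of p0] Ident_right[of p0] by simp
    finally show "p0 \<cdot> (d \<cdot> e) = p0 \<cdot> Ident C (Cod C d)" .
    have "q0 \<cdot> (d \<cdot> e) = b \<cdot> (q1 \<cdot> e)"
      by (rule Comp_eq_extend) (use arrs' in simp_all)
    also have "\<dots> = (b \<cdot> r) \<cdot> q0"
      using arrs' by (simp add: Comp_assoc)
    also have "\<dots> = q0 \<cdot> Ident C (Cod C d)"
      using arrs' sb Ident_left[of q0] Ident_right[of q0] by simp
    finally show "q0 \<cdot> (d \<cdot> e) = q0 \<cdot> Ident C (Cod C d)" .
  qed (use arrs' in \<open>simp_all add: Comp_in Dom_Comp Cod_Comp Ident_in Dom_Ident Cod_Ident Cod_in\<close>)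
  with e.p e.q show thesis by (rule that)
qed

section \<open>Extensions and double extensions under (E1)-(E4)\<close>

locale extension_class = category C
  for C :: "('o, 'm) cat" (structure) and E :: "'m set" +
  assumes E_Arr: "E \<subseteq> Arr C"
    and E1: "axiom_E1 C E" and E2: "axiom_E2 C E" and E3: "axiom_E3 C E" and E4: "axiom_E4 C E"
begin

lemma Ident_E: "A \<in> Obj C \<Longrightarrow> Ident C A \<in> E"
  using E1 Ident_left[of "Ident C A"]
  by (force simp: axiom_E1_def is_iso_def Hom_def Ident_in Dom_Ident Cod_Ident)

lemma Comp_E: "\<lbrakk>f \<in> E; g \<in> E; Cod C f = Dom C g\<rbrakk> \<Longrightarrow> g \<cdot> f \<in> E"
  using E3 by (auto simp: axiom_E3_def)

lemma cancel_E: "\<lbrakk>g \<cdot> f \<in> E; f \<in> Arr C; g \<in> Arr C; Cod C f = Dom C g\<rbrakk> \<Longrightarrow> g \<in> E"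
  using E4 by (auto simp: axiom_E4_def)

lemma pullback_E: "\<lbrakk>is_pullback C f g p q; f \<in> E\<rbrakk> \<Longrightarrow> q \<in> E"
  using E2 is_pullback_arrs[of f g p q] by (auto simp: axiom_E2_def)

lemma pullback_exists:
  assumes "f \<in> E" "g \<in> Arr C" "Cod C f = Cod C g"
  obtains p q where "is_pullback C f g p q"
  using assms E2 unfolding axiom_E2_def by meson

lemma split_epi_E:
  "\<lbrakk>f \<cdot> s = Ident C (Cod C f); f \<in> Arr C; s \<in> Arr C; Cod C s = Dom C f\<rbrakk> \<Longrightarrow> f \<in> E"
  by (rule cancel_E[of f s]) (auto intro: Ident_E Cod_in)

lemma comparison_exists:
  assumes F: "Square a f1 f0 b \<in> Arr (arrow_cat C)" and "f0 \<in> E"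
  obtains p q h where "is_comparison C (Square a f1 f0 b) p q h"
proof -
  note F' = F[unfolded Arr_arrow_cat_iff]
  obtain p q where pq: "is_pullback C f0 b p q"
    using pullback_exists[of f0 b] assms F' by auto
  moreover obtain h where "h \<in> Arr C" "Dom C h = Dom C a" "Cod C h = Dom C p" "p \<cdot> h = a" "q \<cdot> h = f1"
    using is_pullback_induce[OF pq, of a f1] F' by auto
  ultimately have "is_comparison C (Square a f1 f0 b) p q h"
    by (simp add: is_comparison_def)
  then show thesis by (rule that)
qed

text \<open>The same arrow \<open>h\<close> is the comparison morphism of both squares; only the
  projections of its pullback trade places.\<close>

lemma double_ext_transpose:
  assumes "Square a f1 f0 b \<in> double_ext C E"
  shows "Square f1 a b f0 \<in> double_ext C E"
proof -
  obtain p q h where "is_comparison C (Square a f1 f0 b) p q h" "h \<in> E"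
    using assms by (auto simp: double_ext_iff)
  then have "is_comparison C (Square f1 a b f0) q p h"
    using assms is_pullback_sym[of f0 b p q] is_pullback_arrs[of f0 b p q]
    by (auto simp: is_comparison_def double_ext_iff Arr_arrow_cat_iff)
  then show ?thesis
    using assms \<open>h \<in> E\<close> by (auto simp: double_ext_iff Arr_arrow_cat_iff)
qed

text \<open>A pullback of \<open>b\<close> along an identity is \<open>b\<close> itself, so the
  comparison morphism can be taken to be an identity.\<close>

lemma Ident_double_ext:
  assumes "b \<in> E"
  shows "Square b (Ident C (Dom C b)) (Ident C (Cod C b)) b \<in> double_ext C E"
proof -
  have b: "b \<in> Arr C" using assms E_Arr by auto
  note idents = Dom_in[OF b] Cod_in[OF b] Ident_in Dom_Ident Cod_Ident
  have "is_comparison C (Square b (Ident C (Dom C b)) (Ident C (Cod C b)) b)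
      b (Ident C (Dom C b)) (Ident C (Dom C b))"
    using is_pullback_Ident[OF b] Ident_left[of "Ident C (Dom C b)"]
    by (simp add: is_comparison_def idents Ident_right b)
  moreover have "Square b (Ident C (Dom C b)) (Ident C (Cod C b)) b \<in> Arr (arrow_cat C)"
    by (simp add: b Arr_arrow_cat_iff idents Ident_left Ident_right)
  ultimately show ?thesis
    unfolding double_ext_iff using assms Ident_E idents(1,2) by blast
qed

text \<open>The comparison \<open>l\<close> of \<open>(p1, p0)\<close> is a pullback of the comparison \<open>h\<close> of \<open>(g1, g0)\<close>, along a
  pullback \<open>m\<close> of \<open>k1\<close>; so \<open>h \<circ> q1 = m \<circ> l\<close> lies in \<open>E\<close> as soon as \<open>l\<close> does.\<close>

lemma double_ext_descent:
  assumes "arrow_pullback C a b c d k1 k0 g1 g0 p1 p0 q1 q0"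
    and k1: "k1 \<in> E" and P: "Square d p1 p0 a \<in> double_ext C E"
    and E: "b \<in> E" "c \<in> E" "g1 \<in> E" "g0 \<in> E"
  shows "Square b g1 g0 c \<in> double_ext C E"
proof -
  interpret arrow_pullback C a b c d k1 k0 g1 g0 p1 p0 q1 q0 by fact
  obtain w z l where p_cmp: "is_comparison C (Square d p1 p0 a) w z l" and "l \<in> E"
    using P by (auto simp: double_ext_iff)
  obtain u v h where g_cmp: "is_comparison C (Square b g1 g0 c) u v h"
    using comparison_exists[OF g \<open>g0 \<in> E\<close>] .
  obtain m where m: "is_pullback C k1 v z m" and l: "is_pullback C h m q1 l"
    using comparison_pullback[OF g_cmp p_cmp] .
  note l' = is_pullback_arrs[OF l]
  have "m \<in> E"
    using pullback_E[OF m k1] .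
  then have "h \<cdot> q1 \<in> E"
    using Comp_E[OF \<open>l \<in> E\<close> \<open>m \<in> E\<close>] l' by simp
  then have "h \<in> E"
    using cancel_E l' by blast
  then show ?thesis
    using g g_cmp E by (auto simp: double_ext_iff)
qed

text \<open>Factor \<open>d\<close> as \<open>w \<cdot> l\<close> through the comparison
  \<open>l\<close> of \<open>(q1, q0)\<close>. Here \<open>w\<close> is a pullback of
  \<open>b\<close>, and \<open>l\<close> is a pullback of the comparison of
  \<open>(k1, k0)\<close>.\<close>

lemma vertex_E:
  assumes "arrow_pullback C a b c d k1 k0 g1 g0 p1 p0 q1 q0"
    and K: "Square a k1 k0 c \<in> double_ext C E" and b: "b \<in> E"
  shows "d \<in> E"
proof -
  \<comment> \<open>With the two legs exchanged, \<open>comparison_pullback\<close> speaks of the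
    comparisons of \<open>k\<close> and \<open>q\<close> instead of those of \<open>g\<close> and
    \<open>p\<close>.\<close>
  interpret arrow_pullback C b a c d g1 g0 k1 k0 q1 q0 p1 p0
    using arrow_pullback.swap[OF assms(1)] .
  obtain u v h where k_cmp: "is_comparison C (Square a k1 k0 c) u v h" and "h \<in> E" "k0 \<in> E"
    using K by (auto simp: double_ext_iff)
  have "q0 \<in> E"
    using pullback_E[OF is_pullback_sym[OF pb0] \<open>k0 \<in> E\<close>] .
  obtain w z l where q_cmp: "is_comparison C (Square d q1 q0 b) w z l"
    using comparison_exists[OF p \<open>q0 \<in> E\<close>] .
  obtain m where "is_pullback C h m p1 l"
    using comparison_pullback[OF k_cmp q_cmp] .
  then have "l \<in> E"
    using pullback_E \<open>h \<in> E\<close> by blast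
  have "is_pullback C b q0 z w" and l: "Cod C l = Dom C w" "w \<cdot> l = d"
    using q_cmp is_pullback_sym by (auto simp: is_comparison_def)
  then have "w \<in> E"
    using pullback_E b by blast
  with \<open>l \<in> E\<close> l show ?thesis
    using Comp_E[of l w] by simp
qed

section \<open>The implications between conditions (i)-(iv)\<close>

lemma Arr_ext_cat_iff:
  "Square a f1 f0 b \<in> Arr (ext_cat C E) \<longleftrightarrow> Square a f1 f0 b \<in> Arr (arrow_cat C) \<and> a \<in> E \<and> b \<in> E"
  by (auto simp: ext_cat_def full_subcat_def arrow_cat_def)

lemma Comp_ext_cat:
  "Square b g1 g0 c \<cdot>\<^bsub>ext_cat C E\<^esub> Square a f1 f0 b' = Square a (g1 \<cdot> f1) (g0 \<cdot> f0) c"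
  by (simp add: ext_cat_def full_subcat_def arrow_cat_def)

lemma Dom_Cod_ext_cat: "Dom (ext_cat C E) F = sq_dom F" "Cod (ext_cat C E) F = sq_cod F"
  by (simp_all add: ext_cat_def full_subcat_def arrow_cat_def)

text \<open>The projection of the pullback of \<open>g\<close> along \<open>g \<circ> f\<close> has the section \<open>(1, f)\<close>.\<close>

lemma double_ext_right_factor:
  assumes E5: "axiom_E5 C E"
    and ap: "arrow_pullback C a b c d k1 k0 g1 g0 p1 p0 q1 q0"
    and f: "Square a f1 f0 b \<in> Arr (arrow_cat C)" "g1 \<cdot> f1 = k1" "g0 \<cdot> f0 = k0"
    and E: "a \<in> E" "b \<in> E" "c \<in> E" "d \<in> E" "k1 \<in> E" "g1 \<in> E" "g0 \<in> E"
  shows "Square b g1 g0 c \<in> double_ext C E"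
proof -
  interpret arrow_pullback C a b c d k1 k0 g1 g0 p1 p0 q1 q0 by fact
  have "is_split_epi (arrow_cat C) (Square d p1 p0 a)"
    using section_of_factorization[OF f] p unfolding is_split_epi_square_iff by metis
  then have "Square d p1 p0 a \<in> double_ext C E"
    using E5 p E by (auto simp: axiom_E5_def is_split_epi_of_ext_def Arr_ext_cat_iff)
  then show ?thesis
    using double_ext_descent[OF ap] E by blast
qed

text \<open>The section has both ends in \<open>E\<close>, so it is a morphism of the full
  subcategory. Its composite with the split epimorphism is an identity square, a double extension,
  and (E4) cancels the section.\<close>

lemma E5_if_E4_double:
  assumes "axiom_E4 (ext_cat C E) (double_ext C E)"
  shows "axiom_E5 C E"
  unfolding axiom_E5_def
proof (intro allI impI)
  fix F assume F: "is_split_epi_of_ext C E F"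
  obtain a f1 f0 b where F_eq: "F = Square a f1 f0 b" by (cases F)
  then obtain s1 s0 where s: "Square b s1 s0 a \<in> Arr (arrow_cat C)"
    "f1 \<cdot> s1 = Ident C (Dom C b)" "f0 \<cdot> s0 = Ident C (Cod C b)"
    using F by (auto simp: is_split_epi_of_ext_def is_split_epi_square_iff)
  have F_ext: "F \<in> Arr (ext_cat C E)" and "b \<in> E" "a \<in> E"
    using F F_eq by (auto simp: is_split_epi_of_ext_def Arr_ext_cat_iff)
  moreover from this have "Square b s1 s0 a \<in> Arr (ext_cat C E)"
    using s by (simp add: Arr_ext_cat_iff)
  moreover have "F \<cdot>\<^bsub>ext_cat C E\<^esub> Square b s1 s0 a \<in> double_ext C E"
    using Ident_double_ext[OF \<open>b \<in> E\<close>] by (simp add: F_eq Comp_ext_cat s)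
  ultimately show "F \<in> double_ext C E"
    using assms F_eq by (auto simp: axiom_E4_def Dom_Cod_ext_cat)
qed

text \<open>Pull \<open>g\<close> back along \<open>g \<circ> f\<close>. As this composite is a
  double extension, \<open>vertex_E\<close> puts the vertex in \<open>E\<close>; the projection to
  \<open>a\<close> is then a split epimorphism of extensions, as (E5) requires.\<close>

lemma E4_double_if_E5:
  assumes E5: "axiom_E5 C E"
  shows "axiom_E4 (ext_cat C E) (double_ext C E)"
  unfolding axiom_E4_def
proof (intro ballI impI)
  fix F G
  assume FA: "F \<in> Arr (ext_cat C E)" and GA: "G \<in> Arr (ext_cat C E)"
    and GF: "Cod (ext_cat C E) F = Dom (ext_cat C E) G \<and> G \<cdot>\<^bsub>ext_cat C E\<^esub> F \<in> double_ext C E"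
  obtain a f1 f0 b where F: "F = Square a f1 f0 b" by (cases F)
  obtain g1 g0 c where G: "G = Square b g1 g0 c"
    using GF by (cases G) (auto simp: F Dom_Cod_ext_cat)
  have f: "Square a f1 f0 b \<in> Arr (arrow_cat C)" and g: "Square b g1 g0 c \<in> Arr (arrow_cat C)"
    and abc: "a \<in> E" "b \<in> E" "c \<in> E"
    using FA GA by (auto simp: F G Arr_ext_cat_iff)
  have K: "Square a (g1 \<cdot> f1) (g0 \<cdot> f0) c \<in> double_ext C E"
    using GF by (simp add: F G Comp_ext_cat)
  then have k: "Square a (g1 \<cdot> f1) (g0 \<cdot> f0) c \<in> Arr (arrow_cat C)"
    and kE: "g1 \<cdot> f1 \<in> E" "g0 \<cdot> f0 \<in> E"
    by (auto simp: double_ext_iff)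
  note arrs = f[unfolded Arr_arrow_cat_iff] g[unfolded Arr_arrow_cat_iff]
    k[unfolded Arr_arrow_cat_iff]
  have gE: "g1 \<in> E" "g0 \<in> E"
    using cancel_E kE arrs by auto
  obtain p1 q1 where pb1: "is_pullback C (g1 \<cdot> f1) g1 p1 q1"
    using pullback_exists[OF kE(1), of g1] arrs by auto
  obtain p0 q0 where pb0: "is_pullback C (g0 \<cdot> f0) g0 p0 q0"
    using pullback_exists[OF kE(2), of g0] arrs by auto
  obtain d where d: "arrow_pullback C a b c d (g1 \<cdot> f1) (g0 \<cdot> f0) g1 g0 p1 p0 q1 q0"
    using arrow_pullback_induce[OF k g pb1 pb0] .
  have "d \<in> E"
    using vertex_E[OF d K] abc by blast
  then show "G \<in> double_ext C E"
    unfolding G using double_ext_right_factor[OF E5 d f] abc kE gE by blast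
qed

text \<open>The sections of \<open>a\<close> and \<open>b\<close> put these arrows in
  \<open>E\<close>, while \<open>f1'\<close> and \<open>f0'\<close> form the section of the
  square.\<close>

lemma split_epis_of_split_epis_if_E5:
  assumes E5: "axiom_E5 C E"
  shows "split_epis_of_split_epis_double C E"
  unfolding split_epis_of_split_epis_double_def
proof (intro allI impI, elim conjE)
  fix A1 A0 B1 B0 a b f1 f0 a' b' f1' f0'
  assume "a \<in> Hom C A1 A0" "b \<in> Hom C B1 B0" "f1 \<in> Hom C A1 B1" "f0 \<in> Hom C A0 B0"
    "a' \<in> Hom C A0 A1" "b' \<in> Hom C B0 B1" "f1' \<in> Hom C B1 A1" "f0' \<in> Hom C B0 A0"
    "f0 \<cdot> a = b \<cdot> f1" "f0' \<cdot> b = a \<cdot> f1'" "f0 \<cdot> f0' = Ident C B0" "f1 \<cdot> f1' = Ident C B1"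
    "a \<cdot> a' = Ident C A0" "b \<cdot> b' = Ident C B0"
  moreover from this have "a \<in> E" "b \<in> E"
    using split_epi_E[of a a'] split_epi_E[of b b'] by (auto simp: Hom_def)
  moreover have "is_split_epi (arrow_cat C) (Square a f1 f0 b)"
    unfolding is_split_epi_square_iff
    by (intro conjI exI[of _ f1'] exI[of _ f0'])
      (use calculation in \<open>auto simp: Hom_def Arr_arrow_cat_iff\<close>)
  ultimately have "is_split_epi_of_ext C E (Square a f1 f0 b)"
    by (auto simp: is_split_epi_of_ext_def Arr_ext_cat_iff Arr_arrow_cat_iff Hom_def)
  then show "Square a f1 f0 b \<in> double_ext C E"
    using E5 by (simp add: axiom_E5_def)
qed

text \<open>Taking kernel pairs of \<open>a\<close> and \<open>b\<close> turns a split epimorphism of extensions \<open>a \<rightarrow> b\<close> into a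
  split epimorphism of split epimorphisms, from which \<open>double_ext_descent\<close> recovers the transposed
  square.\<close>

lemma E5_if_split_epis_of_split_epis:
  assumes iii: "split_epis_of_split_epis_double C E"
  shows "axiom_E5 C E"
  unfolding axiom_E5_def
proof (intro allI impI)
  fix F assume F: "is_split_epi_of_ext C E F"
  obtain a f1 f0 b where F_eq: "F = Square a f1 f0 b" by (cases F)
  obtain s1 s0 where s: "Square b s1 s0 a \<in> Arr (arrow_cat C)"
    and fs: "f1 \<cdot> s1 = Ident C (Dom C b)" "f0 \<cdot> s0 = Ident C (Cod C b)"
    using F F_eq by (auto simp: is_split_epi_of_ext_def is_split_epi_square_iff)
  have f: "Square a f1 f0 b \<in> Arr (arrow_cat C)" and ab: "a \<in> E" "b \<in> E"
    using F by (auto simp: is_split_epi_of_ext_def Arr_ext_cat_iff F_eq)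
  \<comment> \<open>The square is now read as a morphism \<open>(a, b)\<close> from
    \<open>f1\<close> to \<open>f0\<close>, and its section as a square from \<open>s1\<close> to
    \<open>s0\<close>.\<close>
  have k: "Square f1 a b f0 \<in> Arr (arrow_cat C)" and s': "Square s1 b a s0 \<in> Arr (arrow_cat C)"
    and fs': "f1 \<cdot> s1 = Ident C (Cod C f1)"
    using f s fs by (simp_all add: Arr_arrow_cat_iff)
  have fE: "f1 \<in> E" "f0 \<in> E"
    using split_epi_E[of f1 s1] split_epi_E[of f0 s0] fs f s by (auto simp: Arr_arrow_cat_iff)
  obtain p1 q1 where pb1: "is_pullback C a a p1 q1"
    using pullback_exists[OF ab(1), of a] E_Arr ab by auto
  obtain p0 q0 where pb0: "is_pullback C b b p0 q0"
    using pullback_exists[OF ab(2), of b] E_Arr ab by auto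
  obtain r where r: "arrow_pullback C f1 f1 f0 r a b a b p1 p0 q1 q0"
    using arrow_pullback_induce[OF k k pb1 pb0] .
  interpret arrow_pullback C f1 f1 f0 r a b a b p1 p0 q1 q0 by fact
  \<comment> \<open>Acting by \<open>s1\<close> on both coordinates gives \<open>t\<close>, from the
    kernel pair of \<open>b\<close> back to that of \<open>a\<close>.\<close>
  obtain t where t: "Square t p0 p1 s1 \<in> Arr (arrow_cat C)" "Square t q0 q1 s1 \<in> Arr (arrow_cat C)"
    "r \<cdot> t = Ident C (Cod C r)"
    using section_of_vertex[OF s' fs' s' fs'] .
  \<comment> \<open>Factoring \<open>(a, b)\<close> through the identity square yields the diagonals
    \<open>e1\<close> and \<open>e0\<close>, which split the projection
    \<open>(p1, p0)\<close>.\<close>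
  have "Square f1 (Ident C (Dom C f1)) (Ident C (Cod C f1)) f1 \<in> Arr (arrow_cat C)"
    using arrs by (simp add: Arr_arrow_cat_iff Dom_in Cod_in Ident_in Dom_Ident Cod_Ident
        Ident_left Ident_right)
  moreover have "a \<cdot> Ident C (Dom C f1) = a" "b \<cdot> Ident C (Cod C f1) = b"
    using arrs Ident_right[of a] Ident_right[of b] by simp_all
  ultimately obtain e1 e0 where e: "Square f1 e1 e0 r \<in> Arr (arrow_cat C)"
    "p1 \<cdot> e1 = Ident C (Dom C f1)" "p0 \<cdot> e0 = Ident C (Cod C f1)"
    "q1 \<cdot> e1 = Ident C (Dom C f1)" "q0 \<cdot> e0 = Ident C (Cod C f1)"
    using section_of_factorization by blast
  note arrs' = arrs t(1,2)[unfolded Arr_arrow_cat_iff] e(1)[unfolded Arr_arrow_cat_iff]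
    s'[unfolded Arr_arrow_cat_iff] is_pullback_arrs[OF pb1] is_pullback_arrs[OF pb0]
  \<comment> \<open>For (iii) the two kinds of section must commute,
    \<open>t \<cdot> e0 = e1 \<cdot> s1\<close>. This is the test after one projection, used for
    \<open>(p1, p0)\<close> and again for \<open>(q1, q0)\<close>.\<close>
  have te: "x1 \<cdot> (t \<cdot> e0) = x1 \<cdot> (e1 \<cdot> s1)"
    if x: "x1 \<in> Arr C" "x0 \<in> Arr C" "Dom C x1 = Cod C t" "Dom C x0 = Dom C t" "Cod C x0 = Dom C s1"
      "s1 \<cdot> x0 = x1 \<cdot> t" "x1 \<cdot> e1 = Ident C (Dom C f1)" "x0 \<cdot> e0 = Ident C (Cod C f1)" for x1 x0
  proof -
    have "x1 \<cdot> (t \<cdot> e0) = s1 \<cdot> (x0 \<cdot> e0)"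
      by (rule Comp_eq_extend) (use x arrs' in simp_all)
    also have "\<dots> = (x1 \<cdot> e1) \<cdot> s1"
      using x arrs' Ident_left[of s1] Ident_right[of s1] by simp
    also have "\<dots> = x1 \<cdot> (e1 \<cdot> s1)"
      by (rule Comp_assoc) (use x arrs' in simp_all)
    finally show ?thesis .
  qed
  have "t \<cdot> e0 = e1 \<cdot> s1"
    by (rule is_pullback_unique[OF pb1])
      (use te[of p1 p0] te[of q1 q0] e arrs' in \<open>simp_all add: Comp_in Dom_Comp Cod_Comp\<close>)
  with t e arrs' fs' have "Square r p1 p0 f1 \<in> double_ext C E"
    by (intro iii[unfolded split_epis_of_split_epis_double_def, rule_format, of
        "Dom C r" "Cod C r" "Dom C f1" "Cod C f1" _ _ _ _ t s1 e1 e0])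
      (simp add: Hom_def Dom_in Cod_in)
  then have "Square f1 a b f0 \<in> double_ext C E"
    using double_ext_descent[OF r] ab fE by blast
  then show "F \<in> double_ext C E"
    unfolding F_eq by (rule double_ext_transpose)
qed

text \<open>This is the case \<open>k = g\<close> with vertex \<open>r\<close>. That a double
  extension yields \<open>r\<close> in \<open>E\<close> is \<open>vertex_E\<close>, which rests on
  (E1)-(E4) alone; (E5) enters in the converse, through the diagonal section of the
  projection.\<close>

lemma kernel_pairs_if_E5:
  assumes E5: "axiom_E5 C E"
  shows "kernel_pairs_detect_double C E"
  unfolding kernel_pairs_detect_double_def is_kernel_pair_def
proof (intro allI impI, elim conjE)
  fix a b f1 f0 p1 q1 p0 q0 r
  assume E: "a \<in> E" "b \<in> E" "f1 \<in> E" "f0 \<in> E"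
    and f: "Square a f1 f0 b \<in> Arr (arrow_cat C)"
    and pb: "is_pullback C f1 f1 p1 q1" "is_pullback C f0 f0 p0 q0"
    and r: "r \<in> Hom C (Dom C p1) (Dom C p0)" "p0 \<cdot> r = a \<cdot> p1" "q0 \<cdot> r = a \<cdot> q1"
  note arrs = f[unfolded Arr_arrow_cat_iff] is_pullback_arrs[OF pb(1)] is_pullback_arrs[OF pb(2)]
  have ap: "arrow_pullback C a a b r f1 f0 f1 f0 p1 p0 q1 q0"
    by unfold_locales (use f pb r arrs in \<open>auto simp: Hom_def Arr_arrow_cat_iff\<close>)
  have "Square a (Ident C (Dom C a)) (Ident C (Cod C a)) a \<in> Arr (arrow_cat C)"
    "f1 \<cdot> Ident C (Dom C a) = f1" "f0 \<cdot> Ident C (Cod C a) = f0"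
    using Ident_double_ext[OF E(1)] arrs Ident_right[of f1] Ident_right[of f0]
    by (auto simp: double_ext_iff)
  then show "r \<in> E \<longleftrightarrow> Square a f1 f0 b \<in> double_ext C E"
    using vertex_E[OF ap] double_ext_right_factor[OF E5 ap] E by blast
qed

text \<open>Since \<open>a'\<close> and \<open>b'\<close> commute with \<open>f1\<close> and
  \<open>f0\<close>, \<open>a'\<close> induces a section of \<open>r\<close> on the kernel pairs. So
  \<open>r\<close> is a split epimorphism, hence in \<open>E\<close>, and (iv) applies.\<close>

lemma split_epis_of_split_epis_if_kernel_pairs:
  assumes iv: "kernel_pairs_detect_double C E"
  shows "split_epis_of_split_epis_double C E"
  unfolding split_epis_of_split_epis_double_def
proof (intro allI impI, elim conjE)
  fix A1 A0 B1 B0 a b f1 f0 a' b' f1' f0'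
  assume hom: "a \<in> Hom C A1 A0" "b \<in> Hom C B1 B0" "f1 \<in> Hom C A1 B1" "f0 \<in> Hom C A0 B0"
    "a' \<in> Hom C A0 A1" "b' \<in> Hom C B0 B1" "f1' \<in> Hom C B1 A1" "f0' \<in> Hom C B0 A0"
    and eqs: "f0 \<cdot> a = b \<cdot> f1" "b' \<cdot> f0 = f1 \<cdot> a'"
    "f0 \<cdot> f0' = Ident C B0" "f1 \<cdot> f1' = Ident C B1" "a \<cdot> a' = Ident C A0" "b \<cdot> b' = Ident C B0"
  have E: "a \<in> E" "b \<in> E" "f1 \<in> E" "f0 \<in> E"
    using hom eqs split_epi_E[of a a'] split_epi_E[of b b'] split_epi_E[of f1 f1']
      split_epi_E[of f0 f0'] by (auto simp: Hom_def)
  have f: "Square a f1 f0 b \<in> Arr (arrow_cat C)"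
    and s: "Square a' f0 f1 b' \<in> Arr (arrow_cat C)" "a \<cdot> a' = Ident C (Cod C a)"
    using hom eqs by (auto simp: Hom_def Arr_arrow_cat_iff)
  obtain p1 q1 where pb1: "is_pullback C f1 f1 p1 q1"
    using pullback_exists[OF E(3), of f1] hom by (auto simp: Hom_def)
  obtain p0 q0 where pb0: "is_pullback C f0 f0 p0 q0"
    using pullback_exists[OF E(4), of f0] hom by (auto simp: Hom_def)
  obtain r where "arrow_pullback C a a b r f1 f0 f1 f0 p1 p0 q1 q0"
    using arrow_pullback_induce[OF f f pb1 pb0] .
  then interpret arrow_pullback C a a b r f1 f0 f1 f0 p1 p0 q1 q0 .
  obtain t where "Square t p0 p1 a' \<in> Arr (arrow_cat C)" "r \<cdot> t = Ident C (Cod C r)"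
    using section_of_vertex[OF s s] .
  then have "r \<in> E"
    using arrs by (intro split_epi_E[of r t]) (auto simp: Arr_arrow_cat_iff)
  moreover have "r \<in> Hom C (Dom C p1) (Dom C p0)" "p0 \<cdot> r = a \<cdot> p1" "q0 \<cdot> r = a \<cdot> q1"
    using arrs by (simp_all add: Hom_def)
  ultimately show "Square a f1 f0 b \<in> double_ext C E"
    using iv E f pb1 pb0 unfolding kernel_pairs_detect_double_def is_kernel_pair_def by blast
qed

end

theorem proposition3p3:
  fixes C :: "('o, 'm) cat" and E :: "'m set"
  assumes "category C" and "E \<subseteq> Arr C"
    and "axiom_E1 C E" and "axiom_E2 C E" and "axiom_E3 C E" and "axiom_E4 C E"
  shows "(axiom_E4 (ext_cat C E) (double_ext C E) \<longleftrightarrow> axiom_E5 C E)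
       \<and> (axiom_E5 C E \<longleftrightarrow> split_epis_of_split_epis_double C E)
       \<and> (split_epis_of_split_epis_double C E \<longleftrightarrow> kernel_pairs_detect_double C E)"
proof -
  interpret extension_class C E
    using assms by (simp add: extension_class_def extension_class_axioms_def)
  \<comment> \<open>The implications available are (i) \<longleftrightarrow> (ii), (ii)
    \<longleftrightarrow> (iii) and (ii) \<longrightarrow> (iv) \<longrightarrow> (iii).\<close>
  show ?thesis
    using E5_if_E4_double E4_double_if_E5 split_epis_of_split_epis_if_E5
      E5_if_split_epis_of_split_epis kernel_pairs_if_E5 split_epis_of_split_epis_if_kernel_pairs
    by blast
qed

end
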